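(* Let $X$ be a complex Banach space and let $A,B\in\mathcal{B}(X)^D$. If $A,B$ are $\{A,B\}$-weakly commutative, then $AB$ is Drazin invertible and $(AB)^D=B^DA^D$.
   Context: $\mathcal{B}(X)$ is the algebra of bounded linear operators on the complex Banach space $X$, $I$ the identity operator. $A\in\mathcal{B}(X)$ is Drazin invertible if there is $A^D\in\mathcal{B}(X)$ (the Drazin inverse of $A$, unique when it exists) with $AA^D=A^DA$, $A^DAA^D=A^D$ and $A(I-AA^D)$ nilpotent; $\mathcal{B}(X)^D$ is the set of Drazin invertible operators. Operators $A,B\in\mathcal{B}(X)$ are $A$-weakly commutative if there is $C_1\in\mathcal{B}(X)$ with $AB=C_1A$ and $BA=AC_1$; they are $B$-weakly commutative if there is $C_2\in\mathcal{B}(X)$ with $AB=BC_2$ and $BA=C_2B$; they are $\{A,B\}$-weakly commutative if they are both $A$-weakly commutative and $B$-weakly commutative. *)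

theory Defs
  imports "HOL-Analysis.Analysis"
begin

section \<open>Complex Banach spaces\<close>

class scaleC =
  fixes scaleC :: "complex \<Rightarrow> 'a \<Rightarrow> 'a" (infixr "*\<^sub>C" 75)

text \<open>
  A complex Banach space is a real Banach space whose real scalar multiplication is extended
  to a complex one that is compatible with the norm. The unit law \<open>1 *\<^sub>C x = x\<close> is the instance
  \<open>r = 1\<close> of \<open>scaleC_of_real\<close>.
\<close>

class complex_banach = banach + scaleC +
  assumes scaleC_add_right: "c *\<^sub>C (x + y) = c *\<^sub>C x + c *\<^sub>C y"
    and scaleC_add_left: "(c + d) *\<^sub>C x = c *\<^sub>C x + d *\<^sub>C x"
    and scaleC_scaleC: "c *\<^sub>C (d *\<^sub>C x) = (c * d) *\<^sub>C x"
    and scaleC_of_real: "complex_of_real r *\<^sub>C x = r *\<^sub>R x"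
    and norm_scaleC: "norm (c *\<^sub>C x) = cmod c * norm x"

instantiation complex :: complex_banach
begin

definition scaleC_complex :: "complex \<Rightarrow> complex \<Rightarrow> complex" where
  "scaleC_complex c x = c * x"

instance
  by standard (simp_all add: scaleC_complex_def algebra_simps norm_mult scaleR_conv_of_real)

end

lemma scaleC_zero_right [simp]: "c *\<^sub>C (0 :: 'a :: complex_banach) = 0"
  using scaleC_add_right[of c "0 :: 'a" 0] by simp

lemma scaleC_minus_right: "c *\<^sub>C (- x) = - (c *\<^sub>C (x :: 'a :: complex_banach))"
  using scaleC_add_right[of c x "- x"] by (simp add: eq_neg_iff_add_eq_0 add.commute)

lemma scaleC_diff_right: "c *\<^sub>C (x - y) = c *\<^sub>C x - c *\<^sub>C (y :: 'a :: complex_banach)"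
  using scaleC_add_right[of c x "- y"] by (simp add: scaleC_minus_right)


section \<open>The algebra of bounded complex-linear operators\<close>

typedef (overloaded) 'a bop =
  "{T :: 'a :: complex_banach \<Rightarrow>\<^sub>L 'a. \<forall>c x. blinfun_apply T (c *\<^sub>C x) = c *\<^sub>C blinfun_apply T x}"
  by (rule exI[of _ 0]) simp

setup_lifting type_definition_bop

text \<open>
  Multiplication is composition and \<open>1\<close> is the identity operator. The class \<open>ring_1\<close> is not
  available because it requires \<open>0 \<noteq> 1\<close>, which fails for the zero space.
\<close>

instantiation bop :: (complex_banach) "{ring, monoid_mult}"
begin

lift_definition zero_bop :: "'a bop" is 0 by simp

lift_definition one_bop :: "'a bop" is id_blinfun by simp

lift_definition plus_bop :: "'a bop \<Rightarrow> 'a bop \<Rightarrow> 'a bop" is "(+)"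
  by (simp add: blinfun.add_left scaleC_add_right)

lift_definition minus_bop :: "'a bop \<Rightarrow> 'a bop \<Rightarrow> 'a bop" is "(-)"
  by (simp add: blinfun.diff_left scaleC_diff_right)

lift_definition uminus_bop :: "'a bop \<Rightarrow> 'a bop" is uminus
  by (simp add: blinfun.minus_left scaleC_minus_right)

lift_definition times_bop :: "'a bop \<Rightarrow> 'a bop \<Rightarrow> 'a bop" is blinfun_compose
  by simp

instance
  by standard
    (transfer, auto intro!: blinfun_eqI simp: blinfun.bilinear_simps algebra_simps)+

end


section \<open>Drazin inverses and weak commutativity\<close>

definition nilpotent :: "'a :: complex_banach bop \<Rightarrow> bool" where
  "nilpotent T \<longleftrightarrow> (\<exists>n. T ^ n = 0)"

definition is_drazin_inverse :: "'a :: complex_banach bop \<Rightarrow> 'a bop \<Rightarrow> bool" where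
  "is_drazin_inverse A D \<longleftrightarrow>
     A * D = D * A \<and> D * A * D = D \<and> nilpotent (A * (1 - A * D))"

definition drazin_invertible :: "'a :: complex_banach bop \<Rightarrow> bool" where
  "drazin_invertible A \<longleftrightarrow> (\<exists>D. is_drazin_inverse A D)"

definition drazin_inverse :: "'a :: complex_banach bop \<Rightarrow> 'a bop" where
  "drazin_inverse A = (THE D. is_drazin_inverse A D)"

definition left_weakly_commutative :: "'a :: complex_banach bop \<Rightarrow> 'a bop \<Rightarrow> bool" where
  "left_weakly_commutative A B \<longleftrightarrow> (\<exists>C. A * B = C * A \<and> B * A = A * C)"

definition right_weakly_commutative :: "'a :: complex_banach bop \<Rightarrow> 'a bop \<Rightarrow> bool" where
  "right_weakly_commutative A B \<longleftrightarrow> (\<exists>C. A * B = B * C \<and> B * A = C * B)"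

definition weakly_commutative :: "'a :: complex_banach bop \<Rightarrow> 'a bop \<Rightarrow> bool" where
  "weakly_commutative A B \<longleftrightarrow> left_weakly_commutative A B \<and> right_weakly_commutative A B"

lemma idem_diff_power:
  fixes A P :: "'a :: complex_banach bop"
  assumes "A * P = P * A" "P * P = P"
  shows "(A * (1 - P)) ^ Suc n = A ^ Suc n * (1 - P)"
proof (induction n)
  case 0
  show ?case by simp
next
  case (Suc n)
  have c: "(1 - P) * A = A * (1 - P)" and i: "(1 - P) * (1 - P) = 1 - P"
    using assms by (simp_all add: algebra_simps)
  have "(A * (1 - P)) ^ Suc (Suc n) = (A * (1 - P)) ^ Suc n * (A * (1 - P))"
    by (rule power_Suc2)
  also have "\<dots> = A ^ Suc n * ((1 - P) * A) * (1 - P)"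
    by (simp only: Suc.IH mult.assoc)
  also have "\<dots> = A ^ Suc n * A * ((1 - P) * (1 - P))"
    by (simp only: c mult.assoc)
  also have "\<dots> = A ^ Suc (Suc n) * (1 - P)"
    by (simp only: i power_Suc2)
  finally show ?case .
qed

lemma is_drazin_inverse_power:
  assumes "is_drazin_inverse A D"
  obtains n where "\<And>m. n \<le> m \<Longrightarrow> A ^ m * (1 - A * D) = 0"
proof -
  have c: "A * D = D * A" and d: "D * A * D = D" and "nilpotent (A * (1 - A * D))"
    using assms by (auto simp: is_drazin_inverse_def)
  then obtain n where n: "(A * (1 - A * D)) ^ n = 0"
    by (auto simp: nilpotent_def)
  have p: "A * (A * D) = (A * D) * A" "(A * D) * (A * D) = A * D"
    using c d by (metis mult.assoc)+
  have "A ^ m * (1 - A * D) = 0" if "Suc n \<le> m" for m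
  proof -
    have "A ^ Suc n * (1 - A * D) = (A * (1 - A * D)) ^ Suc n"
      by (rule idem_diff_power[OF p, symmetric])
    also have "\<dots> = 0" using n by simp
    finally have z: "A ^ Suc n * (1 - A * D) = 0" .
    have "A ^ m = A ^ (m - Suc n) * A ^ Suc n"
      using that by (metis power_add le_add_diff_inverse2)
    then show ?thesis by (simp only: mult.assoc z mult_zero_right)
  qed
  then show thesis by (rule that)
qed

lemma is_drazin_inverse_comm_power:
  assumes "is_drazin_inverse A D"
  shows "A ^ n * D ^ n * D = D" "D * (D ^ n * A ^ n) = D"
proof -
  have c: "A * D = D * A" and d: "D * A * D = D"
    using assms by (auto simp: is_drazin_inverse_def)
  have e: "A * D * D = D" using c d by simp
  have f: "D * D * A = D" using c d by (metis mult.assoc)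
  show "A ^ n * D ^ n * D = D"
  proof (induction n)
    case (Suc n)
    have "A ^ Suc n * D ^ Suc n * D = A * (A ^ n * D ^ n * D) * D"
      by (simp add: mult.assoc power_commutes)
    then show ?case using Suc e by simp
  qed simp
  show "D * (D ^ n * A ^ n) = D"
  proof (induction n)
    case (Suc n)
    have "D * (D ^ Suc n * A ^ Suc n) = D * (D * (D ^ n * A ^ n)) * A"
      by (simp add: mult.assoc power_commutes)
    then show ?case using Suc f by simp
  qed simp
qed

lemma is_drazin_inverse_unique:
  assumes D: "is_drazin_inverse A D" and E: "is_drazin_inverse A E"
  shows "D = E"
proof -
  obtain n1 where n1: "\<And>m. n1 \<le> m \<Longrightarrow> A ^ m * (1 - A * D) = 0"
    using is_drazin_inverse_power[OF D] by blast
  obtain n2 where n2: "\<And>m. n2 \<le> m \<Longrightarrow> A ^ m * (1 - A * E) = 0"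
    using is_drazin_inverse_power[OF E] by blast
  define n where "n = max n1 n2"
  have cD: "A * D = D * A"
    using D by (auto simp: is_drazin_inverse_def)
  have "(1 - A * D) * A ^ n = A ^ n * (1 - A * D)"
  proof -
    have "(1 - A * D) * A = A * (1 - A * D)"
      using cD by (metis (no_types) left_diff_distrib right_diff_distrib mult.assoc mult_1_left mult_1_right)
    then show ?thesis by (metis power_commuting_commutes)
  qed
  then have z1: "(1 - A * D) * A ^ n = 0"
    using n1[of n] by (simp add: n_def)
  have z2: "A ^ n * (1 - A * E) = 0" using n2[of n] by (simp add: n_def)
  have "(1 - A * D) * E = (1 - A * D) * (A ^ n * E ^ n * E)"
    by (simp only: is_drazin_inverse_comm_power(1)[OF E])
  also have "\<dots> = ((1 - A * D) * A ^ n) * (E ^ n * E)" by (simp only: mult.assoc)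
  finally have "(1 - A * D) * E = 0" by (simp only: z1 mult_zero_left)
  then have "E = A * D * E" by (simp add: left_diff_distrib)
  moreover have "D * (1 - A * E) = (D * (D ^ n * A ^ n)) * (1 - A * E)"
    by (simp only: is_drazin_inverse_comm_power(2)[OF D])
  then have "D * (1 - A * E) = D * D ^ n * (A ^ n * (1 - A * E))"
    by (simp only: mult.assoc)
  then have "D * (1 - A * E) = 0" by (simp only: z2 mult_zero_right)
  then have "D = D * A * E" by (simp add: right_diff_distrib mult.assoc)
  ultimately show ?thesis using cD by simp
qed

lemma drazin_inverse_eqI: "is_drazin_inverse A D \<Longrightarrow> drazin_inverse A = D"
  unfolding drazin_inverse_def by (blast intro: is_drazin_inverse_unique)

end

theory Submission
  imports Defs
begin

text \<open>
  Write \<open>D\<close>, \<open>E\<close> for the Drazin inverses of \<open>A\<close>, \<open>B\<close>, and \<open>P = A * D\<close>, \<open>Q = B * E\<close> for the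
  associated idempotents. Weak commutativity is weaker than \<open>A * B = B * A\<close>, but it forces
  the square of each operator to commute with the other one: from \<open>A * B = C * A\<close> and
  \<open>B * A = A * C\<close> one gets \<open>B * A\<^sup>2 = A * C * A = A\<^sup>2 * B\<close>. The idempotent \<open>P\<close> commutes
  with everything that commutes with some positive power of \<open>A\<close>, since it splits the space
  into a part on which \<open>A\<close> is invertible and a part on which \<open>A\<close> is nilpotent
  (\<open>commutes_drazin_idempotent\<close>). Hence \<open>P\<close> commutes with \<open>B\<close>, and by the symmetric argument
  \<open>Q\<close> commutes with \<open>A\<close>, hence also with \<open>D\<close> (\<open>commutes_drazin_inverse\<close>). This is all that
  is needed for \<open>A * B * (E * D) = Q * P\<close>, \<open>E * D * (A * B) = Q * P\<close> and
  \<open>E * D * (A * B) * (E * D) = E * D\<close>.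

  For the nilpotency of \<open>A * B * (1 - Q * P)\<close>, the powers of \<open>A * B\<close> have powers of \<open>A\<close> as
  right factors (\<open>left_weakly_commutative_power\<close>), so large ones vanish on the range of
  \<open>1 - P\<close>. By symmetry large powers of \<open>B * A\<close>, and with them those of \<open>A * B\<close>, vanish on
  the range of \<open>1 - Q\<close>. The ranges of \<open>1 - P\<close> and \<open>1 - Q\<close> together span that of \<open>1 - Q * P\<close>.
\<close>

section \<open>What commutes with the Drazin idempotent\<close>

lemma commute_power:
  fixes T A :: "'a :: monoid_mult"
  assumes "T * A = A * T"
  shows "T * A ^ n = A ^ n * T"
  using assms by (metis power_commuting_commutes)

lemma commuting_mult_power:
  fixes X Y :: "'a :: monoid_mult"
  assumes "X * Y = Y * X"
  shows "(X * Y) ^ n = X ^ n * Y ^ n"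
proof (induction n)
  case (Suc n)
  have "(X * Y) ^ Suc n = X * (Y * X ^ n) * Y ^ n"
    by (simp add: Suc mult.assoc)
  also have "Y * X ^ n = X ^ n * Y"
    by (rule commute_power) (simp add: assms)
  finally show ?case by (simp add: mult.assoc)
qed simp

lemma drazin_idempotent:
  assumes "is_drazin_inverse A D"
  shows "(A * D) * (A * D) = A * D"
  using assms by (metis is_drazin_inverse_def mult.assoc)

lemma drazin_idempotent_power:
  assumes "is_drazin_inverse A D" "0 < n"
  shows "A ^ n * D ^ n = A * D" "D ^ n * A ^ n = A * D"
proof -
  have c: "A * D = D * A"
    using assms(1) by (simp add: is_drazin_inverse_def)
  have i: "(A * D) ^ Suc k = A * D" for k
    by (induction k) (simp_all add: drazin_idempotent[OF assms(1)])
  obtain k where n: "n = Suc k"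
    using assms(2) gr0_implies_Suc by blast
  show "A ^ n * D ^ n = A * D"
    using commuting_mult_power[OF c, of n] i[of k] n by simp
  show "D ^ n * A ^ n = A * D"
    using commuting_mult_power[OF c[symmetric], of n] i[of k] n c by simp
qed

text \<open>
  For a large power \<open>M = A ^ m\<close> commuting with \<open>T\<close>, the idempotent \<open>P = A * D\<close> has \<open>M\<close> as a
  factor, while \<open>M\<close> annihilates \<open>1 - P\<close>. Moving \<open>M\<close> across \<open>T\<close> therefore kills both
  off-diagonal blocks \<open>(1 - P) * T * P\<close> and \<open>P * T * (1 - P)\<close>.
\<close>

lemma commutes_drazin_idempotent:
  assumes D: "is_drazin_inverse A D" and "0 < k" and T: "T * A ^ k = A ^ k * T"
  shows "T * (A * D) = (A * D) * T"
proof -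
  obtain n where n: "\<And>m. n \<le> m \<Longrightarrow> A ^ m * (1 - A * D) = 0"
    using is_drazin_inverse_power[OF D] by blast
  define m where "m = k * Suc n"
  have m: "n \<le> m" "0 < m"
    using \<open>0 < k\<close> by (cases k; simp add: m_def)+
  define P where "P = A * D"
  have Tm: "T * A ^ m = A ^ m * T"
    using commute_power[OF T, of "Suc n"] by (simp only: m_def power_mult)
  have z: "A ^ m * (1 - P) = 0"
    using n[OF m(1)] by (simp add: P_def)
  have "A * P = P * A"
    using D unfolding P_def by (metis is_drazin_inverse_def mult.assoc)
  then have "P * A ^ m = A ^ m * P"
    by (metis commute_power)
  then have z': "(1 - P) * A ^ m = 0"
    using z by (simp add: algebra_simps)
  have P: "P = A ^ m * D ^ m" "P = D ^ m * A ^ m"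
    using drazin_idempotent_power[OF D m(2)] by (simp_all add: P_def)
  have "(1 - P) * (T * P) = (1 - P) * (T * A ^ m) * D ^ m"
    by (subst (2) P(1)) (simp only: mult.assoc)
  also have "\<dots> = ((1 - P) * A ^ m) * T * D ^ m"
    by (simp only: Tm mult.assoc)
  also have "\<dots> = 0"
    by (simp only: z' mult_zero_left)
  finally have 1: "T * P = P * T * P"
    by (simp add: left_diff_distrib mult.assoc)
  have "(P * T) * (1 - P) = D ^ m * (A ^ m * T) * (1 - P)"
    by (subst (1) P(2)) (simp only: mult.assoc)
  also have "\<dots> = D ^ m * T * (A ^ m * (1 - P))"
    by (simp only: Tm[symmetric] mult.assoc)
  also have "\<dots> = 0"
    by (simp only: z mult_zero_right)
  finally have 2: "P * T = P * T * P"
    by (simp add: right_diff_distrib)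
  show ?thesis
    using 1 2 by (simp add: P_def)
qed

text \<open>
  With \<open>P = A * D = D * A\<close> commuting with \<open>T\<close>, the factor \<open>D\<close> can be moved across \<open>T\<close>
  by way of \<open>T * D = P * T * D = D * (A * T) * D = D * T * P = D * P * T\<close>.
\<close>

lemma commutes_drazin_inverse:
  assumes D: "is_drazin_inverse A D" and T: "T * A = A * T"
  shows "T * D = D * T"
proof -
  have c: "A * D = D * A" and d: "D * A * D = D"
    using D by (auto simp: is_drazin_inverse_def)
  have P: "T * (A * D) = (A * D) * T"
    by (rule commutes_drazin_idempotent[OF D, of 1]) (simp_all add: T)
  have "T * D = T * (A * D) * D"
    using c d by (simp add: mult.assoc)
  also have "\<dots> = D * (A * T) * D"
    using P c by (metis mult.assoc)
  also have "\<dots> = D * (T * (A * D))"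
    by (simp only: T[symmetric] mult.assoc)
  also have "\<dots> = (D * A * D) * T"
    by (simp only: P mult.assoc)
  finally show ?thesis by (simp only: d)
qed


section \<open>Weak commutativity\<close>

lemma right_weakly_commutative_iff_left:
  "right_weakly_commutative A B \<longleftrightarrow> left_weakly_commutative B A"
  by (auto simp: right_weakly_commutative_def left_weakly_commutative_def)

lemma left_weakly_commutative_square:
  assumes "left_weakly_commutative A B"
  shows "B * A ^ 2 = A ^ 2 * B"
proof -
  obtain C where C: "A * B = C * A" "B * A = A * C"
    using assms by (auto simp: left_weakly_commutative_def)
  show ?thesis
    using C by (metis mult.assoc power2_eq_square)
qed

text \<open>
  \<open>(A * B)\<^sup>2 = C * (A * C) * A = C * B * A\<^sup>2\<close>, where \<open>A\<^sup>2\<close> commutes with \<open>B\<close> and also with \<open>C\<close>,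
  because \<open>C * A\<^sup>2 = A * B * A = A\<^sup>2 * C\<close>.
\<close>

lemma left_weakly_commutative_power:
  assumes "left_weakly_commutative A B"
  obtains X where "(A * B) ^ (2 * n) = X * A ^ (2 * n)"
proof -
  obtain C where C: "A * B = C * A" "B * A = A * C"
    using assms by (auto simp: left_weakly_commutative_def)
  have "C * A ^ 2 = A ^ 2 * C"
    using C by (metis mult.assoc power2_eq_square)
  then have c: "(C * B) * A ^ 2 = A ^ 2 * (C * B)"
    using left_weakly_commutative_square[OF assms] by (metis mult.assoc)
  have "(A * B) ^ 2 = (C * B) * A ^ 2"
    using C by (metis mult.assoc power2_eq_square)
  then have "(A * B) ^ (2 * n) = (C * B) ^ n * A ^ (2 * n)"
    by (simp add: power_mult commuting_mult_power[OF c])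
  then show thesis by (rule that)
qed

lemma left_weakly_commutative_eventually_zero:
  assumes "left_weakly_commutative A B" "is_drazin_inverse A D"
  obtains n where "\<And>m. n \<le> m \<Longrightarrow> (A * B) ^ (2 * m) * (1 - A * D) = 0"
proof -
  obtain n where n: "\<And>m. n \<le> m \<Longrightarrow> A ^ m * (1 - A * D) = 0"
    using is_drazin_inverse_power[OF assms(2)] by blast
  have "(A * B) ^ (2 * m) * (1 - A * D) = 0" if "n \<le> m" for m
  proof -
    obtain X where X: "(A * B) ^ (2 * m) = X * A ^ (2 * m)"
      using left_weakly_commutative_power[OF assms(1)] by blast
    have "A ^ (2 * m) * (1 - A * D) = 0"
      using that by (intro n) simp
    then show ?thesis by (simp only: X mult.assoc mult_zero_right)
  qed
  then show thesis by (rule that)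
qed

lemma left_weakly_commutative_drazin_idempotent:
  assumes "left_weakly_commutative A B" "is_drazin_inverse A D"
  shows "B * (A * D) = (A * D) * B"
  by (rule commutes_drazin_idempotent[OF assms(2), of 2])
    (simp_all add: left_weakly_commutative_square[OF assms(1)])

lemma mult_power_Suc_shift:
  fixes A B :: "'a :: monoid_mult"
  shows "(A * B) ^ Suc n = A * (B * A) ^ n * B"
  by (induction n) (simp_all add: mult.assoc)


section \<open>The reverse order law\<close>

lemma weakly_commutative_is_drazin_inverse:
  assumes w: "weakly_commutative A B"
    and D: "is_drazin_inverse A D" and E: "is_drazin_inverse B E"
  shows "is_drazin_inverse (A * B) (E * D)"
proof -
  have l: "left_weakly_commutative A B" and r: "left_weakly_commutative B A"
    using w by (auto simp: weakly_commutative_def right_weakly_commutative_iff_left)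
  define P where "P = A * D"
  define Q where "Q = B * E"
  have cD: "D * A = P" and cE: "E * B = Q" and dE: "E * Q = E" and dD: "D * P = D"
    using D E by (auto simp: is_drazin_inverse_def P_def Q_def mult.assoc)
  have BP: "B * P = P * B"
    unfolding P_def by (rule left_weakly_commutative_drazin_idempotent[OF l D])
  have AQ: "A * Q = Q * A"
    unfolding Q_def by (rule left_weakly_commutative_drazin_idempotent[OF r E])
  have DQ: "D * Q = Q * D"
    using commutes_drazin_inverse[OF D AQ[symmetric]] by simp
  have PQ: "P * Q = Q * P"
    using AQ DQ by (metis P_def mult.assoc)
  have PP: "P * P = P" and QQ: "Q * Q = Q"
    using drazin_idempotent D E by (simp_all add: P_def Q_def)

  have "A * B * (E * D) = A * Q * D"
    by (simp add: Q_def mult.assoc)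
  then have right: "A * B * (E * D) = Q * P"
    by (simp add: AQ P_def mult.assoc)
  have "E * D * (A * B) = E * (P * B)"
    by (simp add: cD[symmetric] mult.assoc)
  then have left: "E * D * (A * B) = Q * P"
    by (simp add: BP[symmetric] cE[symmetric] mult.assoc)
  have "E * D * (A * B) * (E * D) = E * D * (A * B * (E * D))"
    by (simp only: mult.assoc)
  also have "\<dots> = E * (D * Q) * P"
    by (simp only: right) (simp only: mult.assoc)
  also have "\<dots> = (E * Q) * (D * P)"
    by (simp only: DQ mult.assoc)
  finally have inner: "E * D * (A * B) * (E * D) = E * D"
    by (simp only: dE dD)

  obtain n1 where n1: "\<And>m. n1 \<le> m \<Longrightarrow> (A * B) ^ (2 * m) * (1 - P) = 0"
    using left_weakly_commutative_eventually_zero[OF l D] unfolding P_def by blast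
  obtain n2 where n2: "\<And>m. n2 \<le> m \<Longrightarrow> (B * A) ^ (2 * m) * (1 - Q) = 0"
    using left_weakly_commutative_eventually_zero[OF r E] unfolding Q_def by blast
  define m where "m = max n1 n2"
  have "(A * B) ^ Suc (2 * m) * (1 - P) = (A * B) * ((A * B) ^ (2 * m) * (1 - P))"
    by (simp add: mult.assoc)
  then have zP: "(A * B) ^ Suc (2 * m) * (1 - P) = 0"
    using n1[of m] by (simp add: m_def)
  have "B * Q = Q * B"
    by (metis cE Q_def mult.assoc)
  then have "B * (1 - Q) = (1 - Q) * B"
    by (simp add: algebra_simps)
  then have "(A * B) ^ Suc (2 * m) * (1 - Q) = A * ((B * A) ^ (2 * m) * (1 - Q)) * B"
    by (simp only: mult_power_Suc_shift mult.assoc)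
  then have zQ: "(A * B) ^ Suc (2 * m) * (1 - Q) = 0"
    using n2[of m] by (simp add: m_def)
  have "1 - Q * P = (1 - P) + (1 - Q) * P"
    by (simp add: algebra_simps)
  then have "(A * B) ^ Suc (2 * m) * (1 - Q * P) =
      (A * B) ^ Suc (2 * m) * (1 - P) + ((A * B) ^ Suc (2 * m) * (1 - Q)) * P"
    by (simp only: distrib_left mult.assoc)
  then have z: "(A * B) ^ Suc (2 * m) * (1 - Q * P) = 0"
    by (simp only: zP zQ) simp
  have "(A * B) * (Q * P) = (Q * P) * (A * B)"
    using left right by (metis mult.assoc)
  moreover have "(Q * P) * (Q * P) = Q * P"
    using PP QQ PQ by (metis mult.assoc)
  ultimately have "(A * B * (1 - Q * P)) ^ Suc (2 * m) = 0"
    using idem_diff_power[of "A * B" "Q * P" "2 * m"] z by simp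
  then have "nilpotent (A * B * (1 - A * B * (E * D)))"
    unfolding nilpotent_def right by blast
  then show ?thesis
    using left right inner by (simp add: is_drazin_inverse_def)
qed

theorem theorem3p3:
  fixes A B :: "'a :: complex_banach bop"
  assumes "drazin_invertible A" and "drazin_invertible B"
    and "weakly_commutative A B"
  shows "drazin_invertible (A * B) \<and>
         drazin_inverse (A * B) = drazin_inverse B * drazin_inverse A"
proof -
  obtain D E where D: "is_drazin_inverse A D" and E: "is_drazin_inverse B E"
    using assms(1,2) by (auto simp: drazin_invertible_def)
  have "is_drazin_inverse (A * B) (E * D)"
    by (rule weakly_commutative_is_drazin_inverse[OF assms(3) D E])
  then show ?thesis
    using D E by (auto simp: drazin_invertible_def drazin_inverse_eqI)
qed

end
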